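(* Let $n$ be any positive odd integer. Then, for any complex number $q$ with $|q|=1$ and $q^k\neq 1$ for all $k=1,\ldots,n$, we have $$\mathrm{Re}\left(\sum_{k=1}^n\frac{(-1)^kq^{-k(n-k)/2}}{1-q^k}\right)=-\frac{n+1}{4}.$$ Equivalently, for every real number $x$ we have the trigonometric identity $$\sum_{k=1}^{n}(-1)^kU_{n-k}(\cos kx)=-\frac{n+1}{2}.$$
   Context: For a nonnegative integer $m$, $U_m(z)$ denotes the $m$-th Chebyshev polynomial of the second kind, i.e. the polynomial defined by $U_m(\cos\theta)=\frac{\sin((m+1)\theta)}{\sin\theta}$. Since $n$ is odd, $k(n-k)$ is even for every integer $k$, so the exponent $-k(n-k)/2$ is an integer. $\mathrm{Re}$ denotes the real part. *)

theory Defs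
  imports Complex_Main "HOL-Computational_Algebra.Polynomial"
begin

definition chebyshev_U :: "nat \<Rightarrow> real poly" where
  "chebyshev_U m =
     (THE p. \<forall>\<theta>. sin \<theta> \<noteq> 0 \<longrightarrow> poly p (cos \<theta>) = sin (real (m + 1) * \<theta>) / sin \<theta>)"

lemma chebyshev_U_exists:
  "\<exists>p :: real poly. \<forall>\<theta>. sin \<theta> \<noteq> 0 \<longrightarrow> poly p (cos \<theta>) = sin (real (m + 1) * \<theta>) / sin \<theta>"
proof (induction m rule: induct_nat_012)
  case 0
  show ?case by (rule exI[of _ 1]) simp
next
  case 1
  show ?case by (rule exI[of _ "[:0, 2:]"]) (simp add: sin_double)
next
  case (ge2 m)
  then obtain p q :: "real poly" where
    p: "\<And>\<theta>. sin \<theta> \<noteq> 0 \<Longrightarrow> poly p (cos \<theta>) = sin (real (m + 1) * \<theta>) / sin \<theta>" and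
    q: "\<And>\<theta>. sin \<theta> \<noteq> 0 \<Longrightarrow> poly q (cos \<theta>) = sin (real (Suc m + 1) * \<theta>) / sin \<theta>"
    by blast
  have "sin (real (Suc (Suc m) + 1) * \<theta>)
          = 2 * cos \<theta> * sin (real (Suc m + 1) * \<theta>) - sin (real (m + 1) * \<theta>)" for \<theta>
  proof -
    have "sin (real (Suc m + 1) * \<theta> + \<theta>) + sin (real (Suc m + 1) * \<theta> - \<theta>)
            = 2 * cos \<theta> * sin (real (Suc m + 1) * \<theta>)"
      by (simp only: sin_add sin_diff) simp
    moreover have "real (Suc m + 1) * \<theta> + \<theta> = real (Suc (Suc m) + 1) * \<theta>"
      "real (Suc m + 1) * \<theta> - \<theta> = real (m + 1) * \<theta>"
      by (simp_all add: algebra_simps)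
    ultimately show ?thesis by simp
  qed
  then have "poly ([:0, 2:] * q - p) (cos \<theta>) = sin (real (Suc (Suc m) + 1) * \<theta>) / sin \<theta>"
    if "sin \<theta> \<noteq> 0" for \<theta>
    using p[OF that] q[OF that] by (simp add: diff_divide_distrib)
  then show ?case by blast
qed

lemma poly_cos_unique:
  fixes p q :: "real poly"
  assumes "\<And>\<theta>. sin \<theta> \<noteq> 0 \<Longrightarrow> poly p (cos \<theta>) = poly q (cos \<theta>)"
  shows "p = q"
proof (rule ccontr)
  assume "p \<noteq> q"
  then have "finite {x. poly (p - q) x = 0}"
    by (intro poly_roots_finite) simp
  moreover have "{-1<..<1} \<subseteq> {x. poly (p - q) x = 0}"
  proof
    fix x :: real
    assume x: "x \<in> {-1<..<1}"
    then have "sin (arccos x) \<noteq> 0" by (intro sin_arccos_nonzero) auto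
    from assms[OF this] x show "x \<in> {x. poly (p - q) x = 0}" by simp
  qed
  ultimately have "finite {-1<..<1::real}" by (rule rev_finite_subset)
  moreover have "infinite {-1<..<1::real}" by (rule infinite_Ioo) simp
  ultimately show False by blast
qed

lemma chebyshev_U_cos:
  assumes "sin \<theta> \<noteq> 0"
  shows "poly (chebyshev_U m) (cos \<theta>) = sin (real (m + 1) * \<theta>) / sin \<theta>"
proof -
  obtain p :: "real poly" where
    p: "\<forall>\<theta>. sin \<theta> \<noteq> 0 \<longrightarrow> poly p (cos \<theta>) = sin (real (m + 1) * \<theta>) / sin \<theta>"
    using chebyshev_U_exists by blast
  have "\<forall>\<theta>. sin \<theta> \<noteq> 0 \<longrightarrow> poly (chebyshev_U m) (cos \<theta>) = sin (real (m + 1) * \<theta>) / sin \<theta>"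
    unfolding chebyshev_U_def
  proof (rule theI, rule p)
    fix q :: "real poly"
    assume q: "\<forall>\<theta>. sin \<theta> \<noteq> 0 \<longrightarrow> poly q (cos \<theta>) = sin (real (m + 1) * \<theta>) / sin \<theta>"
    show "q = p" by (rule poly_cos_unique) (simp add: p q del: of_nat_add of_nat_Suc)
  qed
  with assms show ?thesis by blast
qed

end

(* Expanding U_m(cos y) as the sum of the exponentials exp(i b y) over |b| <= m with b of the
   parity of m, the trigonometric sum runs over the pairs (k, b) with k >= 1, |b| <= n - k and
   k + b odd, with terms (-1)^k cos(k b x). Swapping k and |b| changes the sign, because k + b
   is odd, so only the (n + 1)/2 pairs with b = 0 survive. The statement about q = exp(2 i x) is
   the trigonometric identity, since the k-th terms agree up to the factor 1/2. *)
theory Submission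
  imports Defs
begin

lemma chebyshev_U_eqI:
  assumes "\<And>\<theta>. sin \<theta> \<noteq> 0 \<Longrightarrow> poly p (cos \<theta>) = sin (real (m + 1) * \<theta>) / sin \<theta>"
  shows "chebyshev_U m = p"
  by (rule poly_cos_unique) (simp add: assms chebyshev_U_cos del: of_nat_add of_nat_Suc)

lemma chebyshev_U_0: "chebyshev_U 0 = 1"
  by (rule chebyshev_U_eqI) simp

lemma chebyshev_U_1: "chebyshev_U (Suc 0) = [:0, 2:]"
  by (rule chebyshev_U_eqI) (simp add: sin_double)

text \<open>Stated between polynomials, so that it can also be evaluated at angles with
  \<open>sin \<theta> = 0\<close>, about which the defining formula says nothing.\<close>

lemma chebyshev_U_Suc_Suc:
  "chebyshev_U (Suc (Suc m)) = [:0, 2:] * chebyshev_U (Suc m) - chebyshev_U m"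
proof (rule chebyshev_U_eqI)
  fix \<theta> :: real
  assume *: "sin \<theta> \<noteq> 0"
  have "sin (real (m + 2) * \<theta> + \<theta>) + sin (real (m + 2) * \<theta> - \<theta>)
          = 2 * cos \<theta> * sin (real (m + 2) * \<theta>)"
    by (simp only: sin_add sin_diff) simp
  then have "sin (real (Suc (Suc m) + 1) * \<theta>)
          = 2 * cos \<theta> * sin (real (Suc m + 1) * \<theta>) - sin (real (m + 1) * \<theta>)"
    by (simp add: algebra_simps)
  then show "poly ([:0, 2:] * chebyshev_U (Suc m) - chebyshev_U m) (cos \<theta>)
      = sin (real (Suc (Suc m) + 1) * \<theta>) / sin \<theta>"
    using * by (simp add: chebyshev_U_cos diff_divide_distrib)
qed

text \<open>In both \<open>m\<close> and \<open>y\<close> this is U_{m+2} - U_m = 2 T_{m+2} at cos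
  y. Both sides obey the same three-term recurrence, so two base cases suffice; no division by
  \<open>sin y\<close> occurs, hence \<open>y\<close> is arbitrary.\<close>

lemma chebyshev_U_diff_cos:
  "poly (chebyshev_U (Suc (Suc m))) (cos y) = poly (chebyshev_U m) (cos y) + 2 * cos (real (m + 2) * y)"
proof (induction m rule: induct_nat_012)
  case 0
  show ?case
    by (simp add: chebyshev_U_Suc_Suc chebyshev_U_0 chebyshev_U_1 cos_double_cos power2_eq_square)
next
  case 1
  have "cos (3 * y) = 4 * cos y ^ 3 - 3 * cos y"
    by (rule cos_treble_cos)
  then show ?case
    by (simp add: chebyshev_U_Suc_Suc chebyshev_U_0 chebyshev_U_1 power3_eq_cube algebra_simps)
next
  case (ge2 m)
  have "cos (real (m + 3) * y + y) + cos (real (m + 3) * y - y) = 2 * cos y * cos (real (m + 3) * y)"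
    by (simp only: cos_add cos_diff) simp
  then have "cos (real (m + 4) * y) = 2 * cos y * cos (real (m + 3) * y) - cos (real (m + 2) * y)"
    by (simp add: algebra_simps)
  moreover have "poly (chebyshev_U (Suc (Suc (Suc (Suc m))))) (cos y) =
     2 * cos y * poly (chebyshev_U (Suc (Suc (Suc m)))) (cos y) - poly (chebyshev_U (Suc (Suc m))) (cos y)"
    by (simp add: chebyshev_U_Suc_Suc[of "Suc (Suc m)"])
  moreover have "poly (chebyshev_U (Suc (Suc m))) (cos y) =
     2 * cos y * poly (chebyshev_U (Suc m)) (cos y) - poly (chebyshev_U m) (cos y)"
    by (simp add: chebyshev_U_Suc_Suc[of m])
  ultimately show ?case
    using ge2 by (simp add: algebra_simps eval_nat_numeral)
qed

text \<open>Telescopes the previous identity in steps of two. The exponentials for b and -b are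
  merged into 2 cos(b y); the unpaired frequency 0 occurs only for even \<open>m\<close>.\<close>

lemma chebyshev_U_cos_sum:
  "poly (chebyshev_U m) (cos y) =
     of_bool (even m) + 2 * (\<Sum>b | b \<in> {1..m} \<and> even (m + b). cos (real b * y))"
proof (induction m rule: induct_nat_012)
  case 0
  show ?case by (simp add: chebyshev_U_0)
next
  case 1
  have "{b. b \<in> {1..Suc 0} \<and> even (Suc 0 + b)} = {1}" by auto
  then show ?case by (simp add: chebyshev_U_1)
next
  case (ge2 m)
  have "{b. b \<in> {1..Suc (Suc m)} \<and> even (Suc (Suc m) + b)} =
      insert (m + 2) {b. b \<in> {1..m} \<and> even (m + b)}"
    by (auto simp: le_Suc_eq)
  moreover have "m + 2 \<notin> {b. b \<in> {1..m} \<and> even (m + b)}" by simp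
  moreover have "finite {b. b \<in> {1..m} \<and> even (m + b)}" by simp
  ultimately have "(\<Sum>b | b \<in> {1..Suc (Suc m)} \<and> even (Suc (Suc m) + b). cos (real b * y)) =
      cos (real (m + 2) * y) + (\<Sum>b | b \<in> {1..m} \<and> even (m + b). cos (real b * y))"
    by (metis (no_types, lifting) sum.insert)
  then show ?case
    unfolding chebyshev_U_diff_cos ge2 by simp
qed

text \<open>Swapping the coordinates permutes \<open>S\<close> and negates the sum, which is
  therefore its own negative.\<close>

lemma sum_antisym_eq_0:
  fixes f :: "'a \<Rightarrow> 'a \<Rightarrow> real"
  assumes "sym S" and "\<And>a b. (a, b) \<in> S \<Longrightarrow> f b a = - f a b"
  shows "(\<Sum>(a, b)\<in>S. f a b) = 0"
proof -
  have "(\<Sum>(a, b)\<in>S. f a b) = (\<Sum>(a, b)\<in>S. f b a)"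
    by (rule sum.reindex_bij_witness[where i = prod.swap and j = prod.swap])
      (use \<open>sym S\<close> in \<open>auto dest: symD\<close>)
  also have "\<dots> = (\<Sum>(a, b)\<in>S. - f a b)"
    by (rule sum.cong) (auto simp: assms(2))
  also have "\<dots> = - (\<Sum>(a, b)\<in>S. f a b)"
    by (simp add: case_prod_unfold sum_negf)
  finally show ?thesis by simp
qed

lemma sum_chebyshev_U_cos_mult:
  assumes "odd n"
  shows "(\<Sum>k = 1..n. (-1) ^ k * poly (chebyshev_U (n - k)) (cos (real k * x))) = - (real n + 1) / 2"
proof -
  define B where "B k = {b. b \<in> {1..n - k} \<and> even (n - k + b)}" for k
  have "(\<Sum>k = 1..n. \<Sum>b\<in>B k. (-1) ^ k * cos (real b * (real k * x))) =
      (\<Sum>(k, b)\<in>Sigma {1..n} B. (-1) ^ k * cos (real b * (real k * x)))"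
    by (rule sum.Sigma) (auto simp: B_def)
  also have "\<dots> = 0"
  proof (rule sum_antisym_eq_0)
    \<comment> \<open>Membership means k, b >= 1, k + b <= n and k + b of the same parity as n, all
      symmetric in k and b.\<close>
    show "sym (Sigma {1..n} B)"
      by (auto simp: sym_def B_def)
  next
    fix k b assume "(k, b) \<in> Sigma {1..n} B"
    then have "k \<le> n" "even (n - k + b)" by (auto simp: B_def)
    \<comment> \<open>Opposite parities make the two signs differ, while the angle k b x is
      symmetric.\<close>
    with \<open>odd n\<close> have "odd k \<longleftrightarrow> even b" by (simp; blast)
    then show "(-1) ^ b * cos (real k * (real b * x)) = - ((-1) ^ k * cos (real b * (real k * x)))"
      by (cases "even b") (simp_all add: mult.left_commute)
  qed
  finally have off_axis: "(\<Sum>k = 1..n. \<Sum>b\<in>B k. (-1) ^ k * cos (real b * (real k * x))) = 0" .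

  obtain h where h: "n = 2 * h + 1" using \<open>odd n\<close> by (elim oddE)
  \<comment> \<open>As n is odd, frequency 0 occurs exactly for odd k, each time with sign -1; there
    are h + 1 = (n + 1)/2 such k.\<close>
  have "(\<Sum>k = 1..n. (-1) ^ k * of_bool (even (n - k))) = (\<Sum>k = 1..n. - of_bool (odd k) :: real)"
    using \<open>odd n\<close> by (intro sum.cong) auto
  also have "\<dots> = - (real n + 1) / 2"
    unfolding h by (induction h) simp_all
  finally have axis: "(\<Sum>k = 1..n. (-1) ^ k * of_bool (even (n - k))) = - (real n + 1) / 2" .

  have "(\<Sum>k = 1..n. (-1) ^ k * poly (chebyshev_U (n - k)) (cos (real k * x))) =
      (\<Sum>k = 1..n. (-1) ^ k * of_bool (even (n - k))) +
      2 * (\<Sum>k = 1..n. \<Sum>b\<in>B k. (-1) ^ k * cos (real b * (real k * x)))"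
    unfolding chebyshev_U_cos_sum B_def
    by (simp only: distrib_left sum.distrib sum_distrib_left mult.left_commute[of _ 2])
  then show ?thesis
    by (simp only: off_axis axis)
qed

text \<open>Factoring 1 - exp(2 i y) = -2 i sin(y) exp(i y) turns the quotient into i exp(-i (m+1)
  y) / (2 sin y), whose real part is half the defining quotient of U_m.\<close>

lemma Re_cis_div_one_minus_cis:
  assumes "sin y \<noteq> 0"
  shows "Re (cis (- real m * y) / (1 - cis (2 * y))) = poly (chebyshev_U m) (cos y) / 2"
proof -
  have "1 - cis (2 * y) = - 2 * \<i> * of_real (sin y) * cis y"
    by (simp add: complex_eq_iff cos_double_sin sin_double power2_eq_square)
  moreover have "cis (- real m * y) = cis (- (real (m + 1) * y)) * cis y"
    by (simp add: cis_mult algebra_simps)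
  ultimately have "cis (- real m * y) / (1 - cis (2 * y)) =
      \<i> * cis (- (real (m + 1) * y)) / of_real (2 * sin y)"
    using assms by (simp add: divide_simps)
  then have "Re (cis (- real m * y) / (1 - cis (2 * y))) = sin (real (m + 1) * y) / (2 * sin y)"
    by (simp only: Re_divide_of_real) simp
  then show ?thesis
    using chebyshev_U_cos[OF assms, of m] by simp
qed

theorem theorem1:
  fixes n :: nat
  assumes "odd n"
  shows "(\<forall>q :: complex. norm q = 1 \<longrightarrow> (\<forall>k\<in>{1..n}. q ^ k \<noteq> 1) \<longrightarrow>
            Re (\<Sum>k = 1..n. (-1) ^ k * q powi (- (int k * (int n - int k) div 2)) / (1 - q ^ k))
              = - (real n + 1) / 4)
       \<and> (\<forall>x :: real. (\<Sum>k = 1..n. (-1) ^ k * poly (chebyshev_U (n - k)) (cos (real k * x)))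
              = - (real n + 1) / 2)"
proof (intro conjI allI impI)
  fix q :: complex
  assume "norm q = 1" and q_pow: "\<forall>k\<in>{1..n}. q ^ k \<noteq> 1"
  \<comment> \<open>The half angle absorbs the 1/2 in the exponent of q: the k-th term takes the
    form of the previous lemma with y = k x and m = n - k.\<close>
  define x where "x = Arg q / 2"
  have q: "q = cis (2 * x)"
    using \<open>norm q = 1\<close> rcis_cmod_Arg[of q] by (simp add: x_def rcis_def)
  have term_eq: "Re ((-1) ^ k * q powi (- (int k * (int n - int k) div 2)) / (1 - q ^ k)) =
      (-1) ^ k * poly (chebyshev_U (n - k)) (cos (real k * x)) / 2" if k: "k \<in> {1..n}" for k
  proof -
    \<comment> \<open>This makes the integer division by 2 in the exponent exact.\<close>
    have "even (k * (n - k))" using \<open>odd n\<close> k by auto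
    then obtain h where h: "k * (n - k) = 2 * h" by (elim evenE)
    have "int k * (int n - int k) = int (k * (n - k))" using k by (simp add: of_nat_diff)
    also have "\<dots> = 2 * int h" by (simp add: h)
    finally have "int k * (int n - int k) div 2 = int h" by simp
    then have "q powi (- (int k * (int n - int k) div 2)) = cis (- real (2 * h) * x)"
      by (simp add: q cis_power_int mult_ac)
    also have "real (2 * h) = real (n - k) * real k"
      by (metis h mult.commute of_nat_mult)
    finally have num: "q powi (- (int k * (int n - int k) div 2)) = cis (- real (n - k) * (real k * x))"
      by (simp add: mult.assoc)
    have pow: "q ^ k = cis (2 * (real k * x))"
      by (simp add: q Complex.DeMoivre mult.left_commute)
    \<comment> \<open>A zero of the sine here would give q^k = 1, which the hypothesis on q
      excludes.\<close>
    have "sin (real k * x) \<noteq> 0"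
    proof
      assume "sin (real k * x) = 0"
      then have "cis (2 * (real k * x)) = 1"
        by (simp add: complex_eq_iff cos_double_sin sin_double)
      with q_pow k pow show False by simp
    qed
    from Re_cis_div_one_minus_cis[OF this, of "n - k"]
    show ?thesis
      unfolding num pow by (cases "even k") simp_all
  qed
  have "Re (\<Sum>k = 1..n. (-1) ^ k * q powi (- (int k * (int n - int k) div 2)) / (1 - q ^ k)) =
      (\<Sum>k = 1..n. (-1) ^ k * poly (chebyshev_U (n - k)) (cos (real k * x))) / 2"
    unfolding Re_sum sum_divide_distrib by (rule sum.cong[OF refl term_eq])
  then show "Re (\<Sum>k = 1..n. (-1) ^ k * q powi (- (int k * (int n - int k) div 2)) / (1 - q ^ k))
      = - (real n + 1) / 4"
    unfolding sum_chebyshev_U_cos_mult[OF assms] by simp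
qed (rule sum_chebyshev_U_cos_mult[OF assms])

end
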